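(* Let $\sigma\in\mathbb R$, let $V:\mathbb R\to\mathbb R$ be smooth, and let $\hat u(z,k)$ be a family of nonconstant functions, $2\pi$-periodic in $z$ and depending smoothly on $(z,k)$ for $k$ in an open interval of nonzero reals, such that $k^4\hat u_{zzzz}+\sigma k^2\hat u_{zz}+V'(\hat u)=0$ for each $k$. Let $A(k)=\frac1{2\pi}\int_0^{2\pi}(\sigma k\hat u_z^2-2k^3\hat u_{zz}^2)\,dz$. At a value of $k$ with $A_k=A_{kk}=0$, and such that the kernel of $\mathbf L_0=k^4\partial_z^4+\sigma k^2\partial_z^2+V''(\hat u)$ on $2\pi$-periodic functions is spanned by $\hat u_z$, define $$\begin{aligned}\kappa=\Big\langle\Big\langle\hat u_z,\;&2k^3\hat u_{zzzkkk}+15k^2\hat u_{zzzkk}+24k\,\hat u_{zzzk}+6\hat u_{zzz}+\sigma k\,\hat u_{zkkk}+\tfrac52\sigma\hat u_{zkk}\\&+4k^3(\xi_3)_{kzzzz}+6k^2(\xi_3)_{zzzz}+2\sigma k(\xi_3)_{kzz}+\sigma(\xi_3)_{zz}\\&+\tfrac12V''''(\hat u)\hat u_k^2\,\xi_3+\tfrac12V'''(\hat u)\hat u_{kk}\,\xi_3+V'''(\hat u)\hat u_k\,(\xi_3)_k\Big\rangle\Big\rangle ,\end{aligned}$$ where $\xi_3$ and $(\xi_3)_k$ are as defined in the context. Then $$2\kappa=A_{kkk}.$$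
   Context: Inner product of real $2\pi$-periodic functions: $\langle\langle a,b\rangle\rangle=\frac1{2\pi}\int_0^{2\pi}a(z)b(z)\,dz$. Subscripts $z,k$ on $\hat u$ are partial derivatives. $\xi_3$ is a $2\pi$-periodic solution of $$\mathbf L_0\xi_3+M=0,\qquad M:=4k^3\hat u_{zzzk}+6k^2\hat u_{zzz}+2\sigma k\,\hat u_{zk}+\sigma\hat u_z ,$$ which exists when $A_k=0$. The symbol $(\xi_3)_k$ denotes a $2\pi$-periodic solution of the equation obtained by differentiating the $\xi_3$ equation with respect to $k$: $$\mathbf L_0(\xi_3)_k+\big(4k^3\partial_z^4+2\sigma k\,\partial_z^2+V'''(\hat u)\hat u_k\big)\xi_3+M_k=0,\qquad M_k=\partial M/\partial k ,$$ and $(\xi_3)_{kzz}$, $(\xi_3)_{kzzzz}$ are $z$-derivatives of $(\xi_3)_k$. The number $\kappa$ is the coefficient of $q^2q_X$ obtained from the fourth-order solvability condition in the phase modulation reduction of $u_{xxxx}+\sigma u_{xx}+V'(u)=0$. *)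

theory Defs
  imports "HOL-Analysis.Analysis"
begin

primrec C_on :: "nat \<Rightarrow> 'a::euclidean_space set \<Rightarrow> ('a \<Rightarrow> real) \<Rightarrow> bool" where
  "C_on 0 S f \<longleftrightarrow> continuous_on S f"
| "C_on (Suc n) S f \<longleftrightarrow>
     (\<forall>x\<in>S. f differentiable (at x)) \<and> (\<forall>v. C_on n S (\<lambda>x. frechet_derivative f (at x) v))"

(* intended for open S: the derivatives above are taken at x, not within S *)
definition smooth_on :: "'a::euclidean_space set \<Rightarrow> ('a \<Rightarrow> real) \<Rightarrow> bool" where
  "smooth_on S f \<longleftrightarrow> (\<forall>n. C_on n S f)"

definition inner_per :: "(real \<Rightarrow> real) \<Rightarrow> (real \<Rightarrow> real) \<Rightarrow> real" where
  "inner_per a b = 1 / (2 * pi) * integral {0..2 * pi} (\<lambda>z. a z * b z)"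

definition pdz :: "(real \<Rightarrow> real \<Rightarrow> real) \<Rightarrow> real \<Rightarrow> real \<Rightarrow> real" where
  "pdz u = (\<lambda>z k. deriv (\<lambda>s. u s k) z)"

definition pdk :: "(real \<Rightarrow> real \<Rightarrow> real) \<Rightarrow> real \<Rightarrow> real \<Rightarrow> real" where
  "pdk u = (\<lambda>z k. deriv (\<lambda>s. u z s) k)"

(* Functions on which the fourth-order operators below act classically. *)
definition periodic4 :: "(real \<Rightarrow> real) set" where
  "periodic4 = {f. periodic_fun_simple f (2 * pi) \<and>
                   (\<forall>i<4. \<forall>z. (deriv ^^ i) f differentiable (at z))}"

definition L0 :: "(real \<Rightarrow> real) \<Rightarrow> real \<Rightarrow> (real \<Rightarrow> real \<Rightarrow> real) \<Rightarrow> real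
    \<Rightarrow> (real \<Rightarrow> real) \<Rightarrow> real \<Rightarrow> real" where
  "L0 V \<sigma> u k f z =
     k^4 * (deriv ^^ 4) f z + \<sigma> * k^2 * (deriv ^^ 2) f z + (deriv ^^ 2) V (u z k) * f z"

(* The coefficientwise k-derivative of L0. *)
definition L0_k :: "(real \<Rightarrow> real) \<Rightarrow> real \<Rightarrow> (real \<Rightarrow> real \<Rightarrow> real) \<Rightarrow> real
    \<Rightarrow> (real \<Rightarrow> real) \<Rightarrow> real \<Rightarrow> real" where
  "L0_k V \<sigma> u k f z =
     4 * k^3 * (deriv ^^ 4) f z + 2 * \<sigma> * k * (deriv ^^ 2) f z
     + (deriv ^^ 3) V (u z k) * pdk u z k * f z"

definition action :: "real \<Rightarrow> (real \<Rightarrow> real \<Rightarrow> real) \<Rightarrow> real \<Rightarrow> real" where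
  "action \<sigma> u k = 1 / (2 * pi) *
     integral {0..2 * pi} (\<lambda>z. \<sigma> * k * (pdz u z k)^2 - 2 * k^3 * ((pdz ^^ 2) u z k)^2)"

definition M :: "real \<Rightarrow> (real \<Rightarrow> real \<Rightarrow> real) \<Rightarrow> real \<Rightarrow> real \<Rightarrow> real" where
  "M \<sigma> u z k =
     4 * k^3 * pdk ((pdz ^^ 3) u) z k + 6 * k^2 * (pdz ^^ 3) u z k
     + 2 * \<sigma> * k * pdk (pdz u) z k + \<sigma> * pdz u z k"

definition is_xi3 :: "(real \<Rightarrow> real) \<Rightarrow> real \<Rightarrow> (real \<Rightarrow> real \<Rightarrow> real) \<Rightarrow> real
    \<Rightarrow> (real \<Rightarrow> real) \<Rightarrow> bool" where
  "is_xi3 V \<sigma> u k \<xi> \<longleftrightarrow> \<xi> \<in> periodic4 \<and> (\<forall>z. L0 V \<sigma> u k \<xi> z + M \<sigma> u z k = 0)"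

(* xi3 is available only at the given k, so (xi3)_k is a function of z solving the
   formally differentiated equation, not a derivative of a family. *)
definition is_xi3_k :: "(real \<Rightarrow> real) \<Rightarrow> real \<Rightarrow> (real \<Rightarrow> real \<Rightarrow> real) \<Rightarrow> real
    \<Rightarrow> (real \<Rightarrow> real) \<Rightarrow> (real \<Rightarrow> real) \<Rightarrow> bool" where
  "is_xi3_k V \<sigma> u k \<xi> \<xi>k \<longleftrightarrow> \<xi>k \<in> periodic4 \<and>
     (\<forall>z. L0 V \<sigma> u k \<xi>k z + L0_k V \<sigma> u k \<xi> z + pdk (M \<sigma> u) z k = 0)"

definition kappa :: "(real \<Rightarrow> real) \<Rightarrow> real \<Rightarrow> (real \<Rightarrow> real \<Rightarrow> real) \<Rightarrow> real
    \<Rightarrow> (real \<Rightarrow> real) \<Rightarrow> (real \<Rightarrow> real) \<Rightarrow> real" where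
  "kappa V \<sigma> u k \<xi> \<xi>k = inner_per (\<lambda>z. pdz u z k) (\<lambda>z.
     2 * k^3 * (pdk ^^ 3) ((pdz ^^ 3) u) z k + 15 * k^2 * (pdk ^^ 2) ((pdz ^^ 3) u) z k
     + 24 * k * pdk ((pdz ^^ 3) u) z k + 6 * (pdz ^^ 3) u z k
     + \<sigma> * k * (pdk ^^ 3) (pdz u) z k + 5 / 2 * \<sigma> * (pdk ^^ 2) (pdz u) z k
     + 4 * k^3 * (deriv ^^ 4) \<xi>k z + 6 * k^2 * (deriv ^^ 4) \<xi> z
     + 2 * \<sigma> * k * (deriv ^^ 2) \<xi>k z + \<sigma> * (deriv ^^ 2) \<xi> z
     + 1 / 2 * (deriv ^^ 4) V (u z k) * (pdk u z k)^2 * \<xi> z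
     + 1 / 2 * (deriv ^^ 3) V (u z k) * (pdk ^^ 2) u z k * \<xi> z
     + (deriv ^^ 3) V (u z k) * pdk u z k * \<xi>k z)"

end

theory Submission
  imports Defs
begin

text \<open>
  The theorem rests on two computations that meet. Write \<open>L\<close>, \<open>L'\<close>, \<open>L''\<close> for
  \<open>L0\<close> and its first and second coefficientwise derivatives in \<open>k\<close>, and
  \<open>\<langle>a, b\<rangle>\<close> for the periodic inner product.

  On one side, integration by parts turns the derivative of the action into
  \<open>\<langle>u\<^sub>z, M\<rangle>\<close> for every \<open>k\<close> in the interval, so two further differentiations under
  the integral sign give
  \<open>A\<^sub>k\<^sub>k\<^sub>k = \<langle>u\<^sub>z, M\<^sub>k\<^sub>k\<rangle> + 2 \<langle>u\<^sub>z\<^sub>k, M\<^sub>k\<rangle> + \<langle>u\<^sub>z\<^sub>k\<^sub>k, M\<rangle>\<close>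
  (lemma \<open>action_third_deriv\<close>).

  On the other side, the terms of the coefficient free of \<open>\<xi>3\<close> and \<open>\<xi>3k\<close> are exactly half of
  \<open>M\<^sub>k\<^sub>k\<close>, and the remaining ones are half of \<open>L'' \<xi>3 + 2 L' \<xi>3k\<close>. The operators are
  symmetric on periodic functions (lemma \<open>green_identity\<close>), so they may be moved onto \<open>u\<^sub>z\<close>.
  There the identity \<open>L u\<^sub>z = 0\<close>, differentiated once and twice in \<open>k\<close>, gives
  \<open>L' u\<^sub>z = - L u\<^sub>z\<^sub>k\<close> and \<open>L'' u\<^sub>z = - 2 L' u\<^sub>z\<^sub>k - L u\<^sub>z\<^sub>k\<^sub>k\<close>
  (lemma \<open>linearised_equation_k_derivs\<close>). Moving the operators back and inserting the equations
  for \<open>\<xi>3\<close> and \<open>\<xi>3k\<close> produces the same three inner products.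

  The analytic groundwork is that all mixed partial derivatives of \<open>u\<close> exist, are jointly
  continuous and may be taken in any order.
\<close>

section \<open>Smooth functions\<close>

text \<open>
  On an open set the derivative at a point sees only nearby values in the set. This lets the
  values of \<open>frechet_derivative\<close>, which are meaningful only on the strip, be replaced by
  \<open>pdz\<close> and \<open>pdk\<close>.
\<close>

lemma C_on_cong:
  assumes "open S" "C_on n S f" "\<And>x. x \<in> S \<Longrightarrow> f x = g x"
  shows "C_on n S g"
  using assms(2,3)
proof (induction n arbitrary: f g)
  case 0
  then show ?case using continuous_on_cong by force
next
  case (Suc n)
  have der: "(g has_derivative frechet_derivative f (at x)) (at x)" if "x \<in> S" for x
  proof -
    have "(f has_derivative frechet_derivative f (at x)) (at x)"
      using Suc.prems(1) that by (simp add: frechet_derivative_works)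
    then show ?thesis
      by (rule has_derivative_transform_within_open[OF _ assms(1) that Suc.prems(2)])
  qed
  have eq: "frechet_derivative f (at x) = frechet_derivative g (at x)" if "x \<in> S" for x
    using frechet_derivative_at[OF der[OF that]] .
  have "C_on n S (\<lambda>x. frechet_derivative g (at x) v)" for v
    using Suc.IH[of "\<lambda>x. frechet_derivative f (at x) v"] Suc.prems(1) eq by simp
  then show ?case
    using der by (auto simp: differentiable_def)
qed

lemma smooth_on_cong:
  assumes "open S" "smooth_on S f" "\<And>x. x \<in> S \<Longrightarrow> f x = g x"
  shows "smooth_on S g"
  using assms C_on_cong unfolding smooth_on_def by blast

lemma smooth_on_continuous: "smooth_on S f \<Longrightarrow> continuous_on S f"
  by (metis C_on.simps(1) smooth_on_def)

lemma smooth_on_has_derivative: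
  "smooth_on S f \<Longrightarrow> x \<in> S \<Longrightarrow> (f has_derivative frechet_derivative f (at x)) (at x)"
  by (metis C_on.simps(2) frechet_derivative_works smooth_on_def)

lemma smooth_on_frechet_derivative:
  "smooth_on S f \<Longrightarrow> smooth_on S (\<lambda>x. frechet_derivative f (at x) v)"
  by (metis C_on.simps(2) smooth_on_def)

lemma smooth_on_UNIV_deriv:
  fixes V :: "real \<Rightarrow> real"
  assumes "smooth_on UNIV V"
  shows "(V has_real_derivative deriv V x) (at x)" "smooth_on UNIV (deriv V)"
proof -
  have *: "(V has_real_derivative frechet_derivative V (at x) 1) (at x)" for x
  proof -
    have D: "(V has_derivative frechet_derivative V (at x)) (at x)"
      using smooth_on_has_derivative[OF assms] by simp
    then have "frechet_derivative V (at x) = (*) (frechet_derivative V (at x) 1)"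
      using real_linearD[OF has_derivative_linear[OF D]] by (metis mult.right_neutral mult.commute)
    with D show ?thesis by (simp add: has_field_derivative_def)
  qed
  then have eq: "deriv V x = frechet_derivative V (at x) 1" for x
    by (rule DERIV_imp_deriv)
  show "(V has_real_derivative deriv V x) (at x)" using * eq by simp
  show "smooth_on UNIV (deriv V)"
    using smooth_on_cong[OF _ smooth_on_frechet_derivative[OF assms, of 1]] eq by simp
qed

lemma smooth_on_UNIV_higher_deriv:
  fixes V :: "real \<Rightarrow> real"
  assumes "smooth_on UNIV V"
  shows "((deriv ^^ n) V has_real_derivative (deriv ^^ Suc n) V x) (at x)"
proof -
  have "smooth_on UNIV ((deriv ^^ n) V)"
    by (induction n) (simp_all add: assms smooth_on_UNIV_deriv)
  then show ?thesis using smooth_on_UNIV_deriv(1) by simp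
qed

text \<open>
  Iterating \<open>deriv\<close> needs the previous derivative on a whole neighbourhood; the openness of
  \<open>I\<close> supplies it.
\<close>

lemma higher_deriv_eq:
  fixes d :: "nat \<Rightarrow> real \<Rightarrow> real"
  assumes "open I"
    and "\<And>i x. i < n \<Longrightarrow> x \<in> I \<Longrightarrow> (d i has_real_derivative d (Suc i) x) (at x)"
    and "x \<in> I"
  shows "(deriv ^^ n) (d 0) x = d n x"
  using assms(2,3)
proof (induction n arbitrary: x)
  case 0
  then show ?case by simp
next
  case (Suc n)
  have "((deriv ^^ n) (d 0) has_real_derivative d (Suc n) x) (at x)"
    by (rule has_field_derivative_transform_within_open[OF _ assms(1) Suc.prems(2)])
       (use Suc in auto)
  then show ?case by (simp add: DERIV_imp_deriv)
qed

section \<open>Mixed partial derivatives on a strip\<close>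

abbreviation smooth_strip :: "real set \<Rightarrow> (real \<Rightarrow> real \<Rightarrow> real) \<Rightarrow> bool" where
  "smooth_strip I f \<equiv> smooth_on (UNIV \<times> I) (\<lambda>(z, k). f z k)"

lemma smooth_strip_partials:
  assumes I: "open I" and f: "smooth_strip I f"
  shows "k \<in> I \<Longrightarrow> ((\<lambda>s. f s k) has_real_derivative pdz f z k) (at z)"
    and "k \<in> I \<Longrightarrow> (f z has_real_derivative pdk f z k) (at k)"
    and "smooth_strip I (pdz f)" and "smooth_strip I (pdk f)"
proof -
  let ?F = "\<lambda>(z, k). f z k"
  let ?D = "\<lambda>z k. frechet_derivative ?F (at (z, k))"
  have opn: "open (UNIV \<times> I)" using I by (simp add: open_Times)
  have D: "(?F has_derivative ?D z k) (at (z, k))" if "k \<in> I" for z k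
    using smooth_on_has_derivative[OF f] that by simp
  have z: "((\<lambda>s. f s k) has_real_derivative ?D z k (1, 0)) (at z)" if "k \<in> I" for z k
  proof -
    have "((\<lambda>s. ?F (s, k)) has_derivative (\<lambda>h. ?D z k (h, 0))) (at z)"
      by (rule has_derivative_compose[where g="?F" and f="\<lambda>s. (s, k)",
            OF has_derivative_Pair[OF has_derivative_ident has_derivative_const] D[OF that]])
    moreover have "(\<lambda>h. ?D z k (h, 0)) = (*) (?D z k (1, 0))"
    proof
      fix h
      have "?D z k (h *\<^sub>R (1, 0)) = h *\<^sub>R ?D z k (1, 0)"
        by (rule linear_scale[OF has_derivative_linear[OF D[OF that, of z]]])
      then show "?D z k (h, 0) = ?D z k (1, 0) * h" by (simp add: mult.commute)
    qed
    ultimately show ?thesis by (simp only: has_field_derivative_def prod.case)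
  qed
  have k: "(f z has_real_derivative ?D z k (0, 1)) (at k)" if "k \<in> I" for z k
  proof -
    have "((\<lambda>s. ?F (z, s)) has_derivative (\<lambda>h. ?D z k (0, h))) (at k)"
      by (rule has_derivative_compose[where g="?F" and f="\<lambda>s. (z, s)",
            OF has_derivative_Pair[OF has_derivative_const has_derivative_ident] D[OF that]])
    moreover have "(\<lambda>h. ?D z k (0, h)) = (*) (?D z k (0, 1))"
    proof
      fix h
      have "?D z k (h *\<^sub>R (0, 1)) = h *\<^sub>R ?D z k (0, 1)"
        by (rule linear_scale[OF has_derivative_linear[OF D[OF that, of z]]])
      then show "?D z k (0, h) = ?D z k (0, 1) * h" by (simp add: mult.commute)
    qed
    ultimately show ?thesis by (simp only: has_field_derivative_def prod.case)
  qed
  have eqz: "pdz f z k = ?D z k (1, 0)" if "k \<in> I" for z k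
    unfolding pdz_def using z[OF that] by (rule DERIV_imp_deriv)
  have eqk: "pdk f z k = ?D z k (0, 1)" if "k \<in> I" for z k
    unfolding pdk_def using k[OF that] by (rule DERIV_imp_deriv)
  show "((\<lambda>s. f s k) has_real_derivative pdz f z k) (at z)" if "k \<in> I"
    using z eqz that by simp
  show "(f z has_real_derivative pdk f z k) (at k)" if "k \<in> I"
    using k eqk that by simp
  show "smooth_strip I (pdz f)"
    by (rule smooth_on_cong[OF opn smooth_on_frechet_derivative[OF f, of "(1, 0)"]])
       (auto simp: eqz)
  show "smooth_strip I (pdk f)"
    by (rule smooth_on_cong[OF opn smooth_on_frechet_derivative[OF f, of "(0, 1)"]])
       (auto simp: eqk)
qed

lemma smooth_strip_funpow:
  assumes "open I" "smooth_strip I f"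
  shows "smooth_strip I ((pdk ^^ j) ((pdz ^^ i) f))"
proof -
  have "smooth_strip I ((pdz ^^ i) f)"
    by (induction i) (simp_all add: assms smooth_strip_partials(3))
  then show ?thesis
    by (induction j) (simp_all add: assms smooth_strip_partials(4))
qed

lemma continuous_on_strip_slice:
  fixes f :: "real \<Rightarrow> real \<Rightarrow> real"
  assumes "continuous_on (UNIV \<times> I) (\<lambda>(z, k). f z k)" "k \<in> I"
  shows "continuous_on S (\<lambda>z. f z k)"
proof -
  have "continuous_on S (\<lambda>z. (z, k))" by (intro continuous_intros)
  moreover have "(\<lambda>z. (z, k)) ` S \<subseteq> UNIV \<times> I" using assms(2) by auto
  ultimately have "continuous_on S (\<lambda>z. case (z, k) of (z, k) \<Rightarrow> f z k)"
    by (rule continuous_on_compose2[OF assms(1)])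
  then show ?thesis by simp
qed

lemma leibniz_strip:
  fixes f f' :: "real \<Rightarrow> real \<Rightarrow> real"
  assumes I: "open I" "is_interval I"
    and d: "\<And>z k. k \<in> I \<Longrightarrow> (f z has_real_derivative f' z k) (at k)"
    and c: "continuous_on (UNIV \<times> I) (\<lambda>(z, k). f z k)"
    and c': "continuous_on (UNIV \<times> I) (\<lambda>(z, k). f' z k)"
    and k: "k \<in> I"
  shows "((\<lambda>k. integral {a..b} (\<lambda>z. f z k)) has_real_derivative
           integral {a..b} (\<lambda>z. f' z k)) (at k)"
proof -
  have sw: "continuous_on (I \<times> cbox a b) (\<lambda>(k, z). f' z k)"
  proof -
    have "continuous_on (I \<times> cbox a b) (\<lambda>p. (snd p, fst p))" by (intro continuous_intros)
    moreover have "(\<lambda>p. (snd p, fst p)) ` (I \<times> cbox a b) \<subseteq> UNIV \<times> I" by auto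
    ultimately have "continuous_on (I \<times> cbox a b) (\<lambda>p. case (snd p, fst p) of (z, k) \<Rightarrow> f' z k)"
      by (rule continuous_on_compose2[OF c'])
    then show ?thesis by (simp add: case_prod_beta)
  qed
  have "((\<lambda>k. integral (cbox a b) (\<lambda>z. f z k)) has_real_derivative
           integral (cbox a b) (\<lambda>z. f' z k)) (at k within I)"
  proof (rule leibniz_rule_field_derivative[OF _ _ sw k])
    show "((\<lambda>k. f z k) has_real_derivative f' z k) (at k within I)" if "k \<in> I" for z k
      using d[OF that] by (rule has_field_derivative_at_within)
    show "(\<lambda>z. f z k) integrable_on cbox a b" if "k \<in> I" for k
      by (rule integrable_continuous) (rule continuous_on_strip_slice[OF c that])
    show "convex I" using I(2) by (rule is_interval_convex)
  qed
  then show ?thesis by (simp add: at_within_open[OF k I(1)] cbox_interval)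
qed

text \<open>
  Symmetry of second derivatives by way of the integral: differentiating
  \<open>f b k - f a k = \<integral> f\<^sub>z\<close> in \<open>k\<close> under the integral sign gives
  \<open>f\<^sub>k b k - f\<^sub>k a k = \<integral> f\<^sub>z\<^sub>k\<close>, and then differentiating in the upper limit \<open>b\<close> at
  \<open>z\<close> gives the claim, because \<open>f\<^sub>z\<^sub>k\<close> is continuous.
\<close>

lemma pdz_pdk_commute:
  assumes I: "open I" "is_interval I" and f: "smooth_strip I f" and k: "k \<in> I"
  shows "pdz (pdk f) z k = pdk (pdz f) z k"
proof -
  note P = smooth_strip_partials[OF I(1)]
  let ?g = "pdk (pdz f)"
  have c: "continuous_on (UNIV \<times> I) (\<lambda>(z, k). pdz f z k)"
      "continuous_on (UNIV \<times> I) (\<lambda>(z, k). ?g z k)"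
    using P(3)[OF f] P(4)[OF P(3)[OF f]] by (auto intro: smooth_on_continuous)
  \<comment> \<open>Any lower limit to the left of \<open>z\<close> will do.\<close>
  define a where "a = z - 1"
  have ftc: "integral {a..b} (\<lambda>z. pdz f z k) = f b k - f a k" if "a \<le> b" "k \<in> I" for b k
  proof (rule integral_unique, rule fundamental_theorem_of_calculus)
    show "((\<lambda>z. f z k) has_vector_derivative pdz f z k) (at z within {a..b})" for z
      unfolding has_real_derivative_iff_has_vector_derivative[symmetric]
      by (rule has_field_derivative_at_within) (rule P(1)[OF f that(2)])
  qed (rule that)
  have eq: "integral {a..b} (\<lambda>z. ?g z k) = pdk f b k - pdk f a k" if "a \<le> b" for b
  proof -
    have "((\<lambda>k. integral {a..b} (\<lambda>z. pdz f z k)) has_real_derivative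
             integral {a..b} (\<lambda>z. ?g z k)) (at k)"
      by (rule leibniz_strip[OF I P(2)[OF P(3)[OF f]] c k])
    then have "((\<lambda>k. f b k - f a k) has_real_derivative integral {a..b} (\<lambda>z. ?g z k)) (at k)"
      by (rule has_field_derivative_transform_within_open[OF _ I(1) k]) (use ftc that in auto)
    moreover have "((\<lambda>k. f b k - f a k) has_real_derivative pdk f b k - pdk f a k) (at k)"
      by (intro DERIV_diff P(2)[OF f k])
    ultimately show ?thesis by (rule DERIV_unique)
  qed
  have "((\<lambda>b. integral {a..b} (\<lambda>z. ?g z k)) has_real_derivative ?g z k) (at z within {a..z+1})"
    by (rule integral_has_real_derivative[OF continuous_on_strip_slice[OF c(2) k]])
       (auto simp: a_def)
  then have "((\<lambda>b. integral {a..b} (\<lambda>z. ?g z k)) has_real_derivative ?g z k) (at z)"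
    by (simp add: at_within_Icc_at a_def)
  then have "((\<lambda>b. pdk f b k - pdk f a k) has_real_derivative ?g z k) (at z)"
    by (rule has_field_derivative_transform_within_open[of _ _ _ "{a<..}"])
       (auto simp: eq, simp add: a_def)
  then have "((\<lambda>b. pdk f b k - pdk f a k + pdk f a k) has_real_derivative ?g z k + 0) (at z)"
    by (rule DERIV_add) simp
  then show ?thesis by (simp add: pdz_def DERIV_imp_deriv)
qed

text \<open>
  With this fixed order of differentiation, \<open>k\<close>-derivatives are immediate and
  only \<open>z\<close>-derivatives need the symmetry of second derivatives (\<open>jet_deriv_z\<close>).
\<close>

definition jet :: "(real \<Rightarrow> real \<Rightarrow> real) \<Rightarrow> nat \<Rightarrow> nat \<Rightarrow> real \<Rightarrow> real \<Rightarrow> real" where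
  "jet u i j = (pdk ^^ j) ((pdz ^^ i) u)"

lemma jet_continuous:
  "open I \<Longrightarrow> smooth_strip I u \<Longrightarrow> continuous_on (UNIV \<times> I) (\<lambda>(z, k). jet u i j z k)"
  unfolding jet_def by (intro smooth_on_continuous smooth_strip_funpow)

lemma jet_deriv_k:
  assumes "open I" "smooth_strip I u" "k \<in> I"
  shows "(jet u i j z has_real_derivative jet u i (Suc j) z k) (at k)"
  unfolding jet_def using smooth_strip_partials(2)[OF assms(1) smooth_strip_funpow] assms
  by simp

lemma jet_deriv_z:
  assumes I: "open I" "is_interval I" and u: "smooth_strip I u" and k: "k \<in> I"
  shows "((\<lambda>z. jet u i j z k) has_real_derivative jet u (Suc i) j z k) (at z)"
proof -
  have "pdz (jet u i j) z k = jet u (Suc i) j z k"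
    using k
  proof (induction j arbitrary: k)
    case 0
    then show ?case by (simp add: jet_def)
  next
    case (Suc j)
    have sm: "smooth_strip I (jet u i j)"
      unfolding jet_def by (rule smooth_strip_funpow[OF I(1) u])
    have "pdz (jet u i (Suc j)) z k = pdk (pdz (jet u i j)) z k"
      using pdz_pdk_commute[OF I sm Suc.prems] by (simp add: jet_def)
    also have "\<dots> = pdk (jet u (Suc i) j) z k"
      unfolding pdk_def
    proof (rule deriv_cong_ev)
      show "\<forall>\<^sub>F s in nhds k. pdz (jet u i j) z s = jet u (Suc i) j z s"
        using eventually_nhds_in_open[OF I(1) Suc.prems] Suc.IH
        by (auto elim: eventually_mono)
    qed simp
    finally show ?case by (simp add: jet_def)
  qed
  then show ?thesis
    using smooth_strip_partials(1)[OF I(1) smooth_strip_funpow[OF I(1) u] k, of j i z]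
    by (simp add: jet_def)
qed

text \<open>
  The difference quotients at \<open>x\<close> and \<open>x + p\<close> coincide, so this holds even where
  \<open>f\<close> is not differentiable and \<open>deriv\<close> takes its default value.
\<close>

lemma deriv_periodic:
  fixes f :: "real \<Rightarrow> real"
  assumes "\<And>x. f (x + p) = f x"
  shows "deriv f (x + p) = deriv f x"
  using assms by (simp add: deriv_def DERIV_shift)

lemma jet_periodic:
  assumes I: "open I" and per: "\<And>z k. k \<in> I \<Longrightarrow> u (z + p) k = u z k" and k: "k \<in> I"
  shows "jet u i j (z + p) k = jet u i j z k"
  using k
proof (induction j arbitrary: k)
  case 0
  have "(pdz ^^ i) u (z + p) k = (pdz ^^ i) u z k" for z
  proof (induction i arbitrary: z)
    case (Suc i)
    then show ?case by (simp add: pdz_def deriv_periodic)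
  qed (simp add: per 0)
  then show ?case by (simp add: jet_def)
next
  case (Suc j)
  have "pdk (jet u i j) (z + p) k = pdk (jet u i j) z k"
    unfolding pdk_def
    by (rule deriv_cong_ev)
       (use eventually_nhds_in_open[OF I Suc.prems] Suc.IH in \<open>auto elim: eventually_mono\<close>)
  then show ?case by (simp add: jet_def)
qed

section \<open>Periodic integrals and Green's identity\<close>

lemma has_integral_periodic_derivative:
  fixes W :: "real \<Rightarrow> real"
  assumes "\<And>z. (W has_real_derivative w z) (at z)" "W p = W 0" "0 \<le> p"
  shows "(w has_integral 0) {0..p}"
proof -
  have "(w has_integral W p - W 0) {0..p}"
  proof (rule fundamental_theorem_of_calculus)
    show "(W has_vector_derivative w z) (at z within {0..p})" for z
      unfolding has_real_derivative_iff_has_vector_derivative[symmetric]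
      by (rule has_field_derivative_at_within) (rule assms(1))
  qed (rule assms(3))
  then show ?thesis using assms(2) by simp
qed

text \<open>
  Symmetry of \<open>\<alpha> \<partial>\<^sup>4 + \<beta> \<partial>\<^sup>2\<close> on periodic functions: the integrand is the derivative of the
  bilinear concomitant \<open>?W\<close> below. Working with the concomitant avoids integrating the two
  halves separately, so fourth derivatives need only exist, not be continuous.
  The functions and their derivatives are passed as sequences so that the lemma applies equally
  to mixed partials and to iterated \<open>deriv\<close>.
\<close>

lemma green_identity:
  fixes a f :: "nat \<Rightarrow> real \<Rightarrow> real"
  assumes da: "\<And>i z. i < 4 \<Longrightarrow> (a i has_real_derivative a (Suc i) z) (at z)"
    and df: "\<And>i z. i < 4 \<Longrightarrow> (f i has_real_derivative f (Suc i) z) (at z)"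
    and pa: "\<And>i. i < 4 \<Longrightarrow> a i p = a i 0"
    and pf: "\<And>i. i < 4 \<Longrightarrow> f i p = f i 0"
    and p: "0 \<le> p"
  shows "((\<lambda>z. a 0 z * (\<alpha> * f 4 z + \<beta> * f 2 z) - f 0 z * (\<alpha> * a 4 z + \<beta> * a 2 z))
           has_integral 0) {0..p}"
proof -
  let ?W = "\<lambda>z. \<alpha> * (a 0 z * f 3 z - a 1 z * f 2 z + a 2 z * f 1 z - a 3 z * f 0 z)
              + \<beta> * (a 0 z * f 1 z - a 1 z * f 0 z)"
  have D: "(a 0 has_real_derivative a 1 z) (at z)" "(a 1 has_real_derivative a 2 z) (at z)"
      "(a 2 has_real_derivative a 3 z) (at z)" "(a 3 has_real_derivative a 4 z) (at z)"
      "(f 0 has_real_derivative f 1 z) (at z)" "(f 1 has_real_derivative f 2 z) (at z)"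
      "(f 2 has_real_derivative f 3 z) (at z)" "(f 3 has_real_derivative f 4 z) (at z)" for z
    using da[of 0 z] da[of 1 z] da[of 2 z] da[of 3 z] df[of 0 z] df[of 1 z] df[of 2 z] df[of 3 z]
    by (simp_all add: eval_nat_numeral)
  have "(?W has_real_derivative
      a 0 z * (\<alpha> * f 4 z + \<beta> * f 2 z) - f 0 z * (\<alpha> * a 4 z + \<beta> * a 2 z)) (at z)" for z
    by (auto intro!: derivative_eq_intros D simp del: One_nat_def simp: algebra_simps)
  moreover have "?W p = ?W 0" using pa pf by simp
  ultimately show ?thesis using p by (rule has_integral_periodic_derivative)
qed

lemma periodic4_derivs:
  assumes "f \<in> periodic4"
  shows "i < 4 \<Longrightarrow> ((deriv ^^ i) f has_real_derivative (deriv ^^ Suc i) f z) (at z)"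
    and "(deriv ^^ i) f (2 * pi) = (deriv ^^ i) f 0"
proof -
  show "((deriv ^^ i) f has_real_derivative (deriv ^^ Suc i) f z) (at z)" if "i < 4"
    using assms that by (auto simp: periodic4_def DERIV_deriv_iff_real_differentiable)
  have "(deriv ^^ i) f (z + 2 * pi) = (deriv ^^ i) f z" for z
  proof (induction i arbitrary: z)
    case 0
    then show ?case using assms by (simp add: periodic4_def periodic_fun_simple_def)
  next
    case (Suc i)
    then show ?case by (simp add: deriv_periodic)
  qed
  from this[of 0] show "(deriv ^^ i) f (2 * pi) = (deriv ^^ i) f 0" by simp
qed

section \<open>The modulation coefficient\<close>

text \<open>
  The expanded first and second \<open>k\<close>-derivatives of \<open>M\<close>, identified as such in
  \<open>M_has_k_derivs\<close>. Half of \<open>M_kk\<close> is the \<open>\<xi>3\<close>-free part of the modulation coefficient.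
\<close>

definition M_k :: "real \<Rightarrow> (real \<Rightarrow> real \<Rightarrow> real) \<Rightarrow> real \<Rightarrow> real \<Rightarrow> real" where
  "M_k \<sigma> u z k =
     4 * k^3 * jet u 3 2 z k + 18 * k^2 * jet u 3 1 z k + 12 * k * jet u 3 0 z k
     + 2 * \<sigma> * k * jet u 1 2 z k + 3 * \<sigma> * jet u 1 1 z k"

definition M_kk :: "real \<Rightarrow> (real \<Rightarrow> real \<Rightarrow> real) \<Rightarrow> real \<Rightarrow> real \<Rightarrow> real" where
  "M_kk \<sigma> u z k =
     4 * k^3 * jet u 3 3 z k + 30 * k^2 * jet u 3 2 z k + 48 * k * jet u 3 1 z k
     + 12 * jet u 3 0 z k + 2 * \<sigma> * k * jet u 1 3 z k + 5 * \<sigma> * jet u 1 2 z k"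

lemma M_jet:
  "M \<sigma> u z k = 4 * k^3 * jet u 3 1 z k + 6 * k^2 * jet u 3 0 z k
     + 2 * \<sigma> * k * jet u 1 1 z k + \<sigma> * jet u 1 0 z k"
  by (simp add: M_def jet_def)

lemma M_has_k_derivs:
  assumes I: "open I" and u: "smooth_strip I u" and k: "k \<in> I"
  shows "(M \<sigma> u z has_real_derivative M_k \<sigma> u z k) (at k)"
    and "(M_k \<sigma> u z has_real_derivative M_kk \<sigma> u z k) (at k)"
proof -
  note D = jet_deriv_k[OF I u k]
  have D': "(jet u i 0 z has_real_derivative jet u i 1 z k) (at k)"
    "(jet u i 1 z has_real_derivative jet u i 2 z k) (at k)"
    "(jet u i 2 z has_real_derivative jet u i 3 z k) (at k)" for i
    using D[of i 0 z] D[of i 1 z] D[of i 2 z] by (simp_all add: eval_nat_numeral)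
  show "(M \<sigma> u z has_real_derivative M_k \<sigma> u z k) (at k)"
    unfolding M_jet[abs_def] M_k_def
    by (auto intro!: derivative_eq_intros D' simp del: One_nat_def simp: algebra_simps power2_eq_square)
  show "(M_k \<sigma> u z has_real_derivative M_kk \<sigma> u z k) (at k)"
    unfolding M_k_def[abs_def] M_kk_def
    by (auto intro!: derivative_eq_intros D' simp del: One_nat_def simp: algebra_simps power2_eq_square)
qed

text \<open>
  After the first differentiation the integrand is changed by a total \<open>z\<close>-derivative to
  \<open>u\<^sub>z M\<close>. This is done once, for all \<open>k\<close> in the interval, so that the two remaining
  derivatives act on a single product.
\<close>

lemma action_third_deriv:
  assumes I: "open I" "is_interval I" and u: "smooth_strip I u"
    and per: "\<And>z k. k \<in> I \<Longrightarrow> u (z + 2 * pi) k = u z k" and k: "k \<in> I"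
  shows "(deriv ^^ 3) (action \<sigma> u) k = 1 / (2 * pi) * integral {0..2 * pi} (\<lambda>z.
    jet u 1 0 z k * M_kk \<sigma> u z k + 2 * jet u 1 1 z k * M_k \<sigma> u z k + jet u 1 2 z k * M \<sigma> u z k)"
proof -
  note cj = jet_continuous[OF I(1) u]
  note [continuous_intros] = cj[unfolded case_prod_beta]
  have D: "(jet u i 0 z has_real_derivative jet u i 1 z k) (at k)"
    "(jet u i 1 z has_real_derivative jet u i 2 z k) (at k)" if "k \<in> I" for i z k
    using jet_deriv_k[OF I(1) u that, of i 0 z] jet_deriv_k[OF I(1) u that, of i 1 z]
    by (simp_all add: eval_nat_numeral)
  note DM = M_has_k_derivs[OF I(1) u]
  define f where "f j = (case j of
      0 \<Rightarrow> (\<lambda>z k. \<sigma> * k * (jet u 1 0 z k)^2 - 2 * k^3 * (jet u 2 0 z k)^2)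
    | Suc 0 \<Rightarrow> (\<lambda>z k. jet u 1 0 z k * M \<sigma> u z k)
    | Suc (Suc 0) \<Rightarrow> (\<lambda>z k. jet u 1 0 z k * M_k \<sigma> u z k + jet u 1 1 z k * M \<sigma> u z k)
    | _ \<Rightarrow> (\<lambda>z k. jet u 1 0 z k * M_kk \<sigma> u z k + 2 * jet u 1 1 z k * M_k \<sigma> u z k
              + jet u 1 2 z k * M \<sigma> u z k))" for j :: nat
  define F where "F j k = 1 / (2 * pi) * integral {0..2 * pi} (\<lambda>z. f j z k)" for j k
  have f: "f 0 = (\<lambda>z k. \<sigma> * k * (jet u 1 0 z k)^2 - 2 * k^3 * (jet u 2 0 z k)^2)"
    "f 1 = (\<lambda>z k. jet u 1 0 z k * M \<sigma> u z k)"
    "f 2 = (\<lambda>z k. jet u 1 0 z k * M_k \<sigma> u z k + jet u 1 1 z k * M \<sigma> u z k)"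
    "f 3 = (\<lambda>z k. jet u 1 0 z k * M_kk \<sigma> u z k + 2 * jet u 1 1 z k * M_k \<sigma> u z k
              + jet u 1 2 z k * M \<sigma> u z k)"
    unfolding f_def by (simp_all add: eval_nat_numeral)
  have c: "continuous_on (UNIV \<times> I) (\<lambda>(z, k). f 0 z k)"
    "continuous_on (UNIV \<times> I) (\<lambda>(z, k). f 1 z k)"
    "continuous_on (UNIV \<times> I) (\<lambda>(z, k). f 2 z k)"
    "continuous_on (UNIV \<times> I) (\<lambda>(z, k). f 3 z k)"
    unfolding f M_jet M_k_def M_kk_def case_prod_beta by (intro continuous_intros)+
  have F0: "(F 0 has_real_derivative F 1 k) (at k)" if k: "k \<in> I" for k
  proof -
    let ?g = "\<lambda>z k. \<sigma> * (jet u 1 0 z k)^2 + 2 * \<sigma> * k * jet u 1 0 z k * jet u 1 1 z k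
                - 6 * k^2 * (jet u 2 0 z k)^2 - 4 * k^3 * jet u 2 0 z k * jet u 2 1 z k"
    have g: "(f 0 z has_real_derivative ?g z k) (at k)" if "k \<in> I" for z k
      unfolding f by (auto intro!: derivative_eq_intros D[OF that] simp del: One_nat_def simp: power2_eq_square)
    have cg: "continuous_on (UNIV \<times> I) (\<lambda>(z, k). ?g z k)"
      unfolding case_prod_beta by (intro continuous_intros)
    \<comment> \<open>The boundary term from moving one \<open>z\<close>-derivative in \<open>u\<^sub>z\<^sub>z u\<^sub>z\<^sub>z\<^sub>k\<close> and in \<open>u\<^sub>z\<^sub>z\<^sup>2\<close>.\<close>
    let ?W = "\<lambda>z. 4 * k^3 * (jet u 1 0 z k * jet u 2 1 z k)
                + 6 * k^2 * (jet u 1 0 z k * jet u 2 0 z k)"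
    have Dz: "((\<lambda>z. jet u 1 j z k) has_real_derivative jet u 2 j z k) (at z)"
      "((\<lambda>z. jet u 2 j z k) has_real_derivative jet u 3 j z k) (at z)" for j z
      using jet_deriv_z[OF I u k, of 1 j z] jet_deriv_z[OF I u k, of 2 j z]
      by (simp_all add: eval_nat_numeral)
    have W: "((\<lambda>z. f 1 z k - ?g z k) has_integral 0) {0..2 * pi}"
    proof (rule has_integral_periodic_derivative)
      show "(?W has_real_derivative f 1 z k - ?g z k) (at z)" for z
        unfolding f M_jet
        by (auto intro!: derivative_eq_intros Dz simp del: One_nat_def simp: algebra_simps power2_eq_square)
      show "?W (2 * pi) = ?W 0"
        using jet_periodic[where p="2*pi" and z=0 and u=u, OF I(1) per k] by simp
    qed simp
    have "(\<lambda>z. f 1 z k) integrable_on {0..2 * pi}" "(\<lambda>z. ?g z k) integrable_on {0..2 * pi}"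
      by (rule integrable_continuous_real, rule continuous_on_strip_slice[OF c(2) k],
          rule integrable_continuous_real, rule continuous_on_strip_slice[OF cg k])
    then have "integral {0..2 * pi} (\<lambda>z. f 1 z k) - integral {0..2 * pi} (\<lambda>z. ?g z k) = 0"
      using integral_unique[OF W] by (simp only: integral_diff)
    then have "F 1 k = 1 / (2 * pi) * integral {0..2 * pi} (\<lambda>z. ?g z k)"
      by (simp add: F_def)
    moreover have "(F 0 has_real_derivative 1 / (2 * pi) * integral {0..2 * pi} (\<lambda>z. ?g z k)) (at k)"
      unfolding F_def by (rule DERIV_cmult) (rule leibniz_strip[OF I g c(1) cg k])
    ultimately show ?thesis by simp
  qed
  have f1: "(f 1 z has_real_derivative f 2 z k) (at k)"
    and f2: "(f 2 z has_real_derivative f 3 z k) (at k)" if "k \<in> I" for z k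
    unfolding f by (auto intro!: derivative_eq_intros D[OF that] DM[OF that] simp del: One_nat_def simp: algebra_simps)
  have F1: "(F 1 has_real_derivative F 2 k) (at k)"
    and F2: "(F 2 has_real_derivative F 3 k) (at k)" if "k \<in> I" for k
  proof -
    show "(F 1 has_real_derivative F 2 k) (at k)"
      unfolding F_def by (rule DERIV_cmult) (rule leibniz_strip[OF I f1 c(2,3) that])
    show "(F 2 has_real_derivative F 3 k) (at k)"
      unfolding F_def by (rule DERIV_cmult) (rule leibniz_strip[OF I f2 c(3,4) that])
  qed
  have "(F j has_real_derivative F (Suc j) k) (at k)" if j: "j < 3" and k': "k \<in> I" for j k
  proof -
    consider "j = 0" | "j = 1" | "j = 2" using j by linarith
    then show ?thesis
      using F0[OF k'] F1[OF k'] F2[OF k'] by cases (simp_all add: eval_nat_numeral)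
  qed
  then have "(deriv ^^ 3) (F 0) k = F 3 k"
    by (rule higher_deriv_eq[OF I(1) _ k])
  moreover have "F 0 = action \<sigma> u"
    unfolding F_def action_def f by (simp add: jet_def fun_eq_iff)
  ultimately show ?thesis by (simp add: F_def f)
qed

text \<open>
  The \<open>z\<close>-derivative of the equation for \<open>u\<close> is \<open>L u\<^sub>z = 0\<close>. It holds for all
  \<open>k\<close> in the interval, hence may be differentiated in \<open>k\<close>; the result is
  \<open>L u\<^sub>z\<^sub>k + L' u\<^sub>z = 0\<close> and \<open>L u\<^sub>z\<^sub>k\<^sub>k + 2 L' u\<^sub>z\<^sub>k + L'' u\<^sub>z = 0\<close>, written out.
\<close>

lemma linearised_equation_k_derivs:
  assumes V: "smooth_on UNIV V" and I: "open I" "is_interval I" and u: "smooth_strip I u"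
    and eq: "\<And>z k. k \<in> I \<Longrightarrow>
      k^4 * jet u 4 0 z k + \<sigma> * k^2 * jet u 2 0 z k + deriv V (u z k) = 0"
    and k: "k \<in> I"
  shows "k^4 * jet u 5 0 z k + \<sigma> * k^2 * jet u 3 0 z k + (deriv ^^ 2) V (u z k) * jet u 1 0 z k = 0"
      (is "?E0 z k = 0")
    and "k^4 * jet u 5 1 z k + \<sigma> * k^2 * jet u 3 1 z k + (deriv ^^ 2) V (u z k) * jet u 1 1 z k
      + (4 * k^3 * jet u 5 0 z k + 2 * \<sigma> * k * jet u 3 0 z k
         + (deriv ^^ 3) V (u z k) * jet u 0 1 z k * jet u 1 0 z k) = 0"
      (is "?E1 z k = 0")
    and "k^4 * jet u 5 2 z k + \<sigma> * k^2 * jet u 3 2 z k + (deriv ^^ 2) V (u z k) * jet u 1 2 z k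
      + 2 * (4 * k^3 * jet u 5 1 z k + 2 * \<sigma> * k * jet u 3 1 z k
         + (deriv ^^ 3) V (u z k) * jet u 0 1 z k * jet u 1 1 z k)
      + (12 * k^2 * jet u 5 0 z k + 2 * \<sigma> * jet u 3 0 z k
         + ((deriv ^^ 4) V (u z k) * (jet u 0 1 z k)^2 + (deriv ^^ 3) V (u z k) * jet u 0 2 z k)
           * jet u 1 0 z k) = 0"
      (is "?E2 z k = 0")
proof -
  have zero: "d = 0" if "(h has_real_derivative d) (at x)" "\<And>y. y \<in> S \<Longrightarrow> h y = 0"
    "open S" "x \<in> S" for h d x and S :: "real set"
    using DERIV_unique[OF has_field_derivative_transform_within_open[OF that(1,3,4)], of "\<lambda>_. 0" 0]
      that(2) by simp
  have Dz: "((\<lambda>z. u z k) has_real_derivative jet u 1 0 z k) (at z)"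
    "((\<lambda>z. jet u 2 0 z k) has_real_derivative jet u 3 0 z k) (at z)"
    "((\<lambda>z. jet u 4 0 z k) has_real_derivative jet u 5 0 z k) (at z)" if "k \<in> I" for z k
    using jet_deriv_z[OF I u that, of 0 0 z] jet_deriv_z[OF I u that, of 2 0 z]
      jet_deriv_z[OF I u that, of 4 0 z]
    by (simp_all add: eval_nat_numeral jet_def)
  have Dk: "(jet u i 0 z has_real_derivative jet u i 1 z k) (at k)"
    "(jet u i 1 z has_real_derivative jet u i 2 z k) (at k)"
    "(u z has_real_derivative jet u 0 1 z k) (at k)" if "k \<in> I" for i z k
    using jet_deriv_k[OF I(1) u that, of i 0 z] jet_deriv_k[OF I(1) u that, of i 1 z]
      jet_deriv_k[OF I(1) u that, of 0 0 z]
    by (simp_all add: eval_nat_numeral jet_def)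
  have DV: "((\<lambda>s. (deriv ^^ n) V (g s)) has_real_derivative (deriv ^^ Suc n) V (g s) * g') (at s)"
    if "(g has_real_derivative g') (at s)" for n g g' s
    using DERIV_chain2[OF smooth_on_UNIV_higher_deriv[OF V] that] .
  have DV': "(g has_real_derivative g') (at s) \<Longrightarrow>
        ((\<lambda>s. deriv V (g s)) has_real_derivative (deriv ^^ 2) V (g s) * g') (at s)"
    "(g has_real_derivative g') (at s) \<Longrightarrow>
        ((\<lambda>s. (deriv ^^ 2) V (g s)) has_real_derivative (deriv ^^ 3) V (g s) * g') (at s)"
    "(g has_real_derivative g') (at s) \<Longrightarrow>
        ((\<lambda>s. (deriv ^^ 3) V (g s)) has_real_derivative (deriv ^^ 4) V (g s) * g') (at s)"
    for g g' s
    using DV[of g g' s 1] DV[of g g' s 2] DV[of g g' s 3] by (simp_all add: eval_nat_numeral)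
  have E0: "?E0 z k = 0" if "k \<in> I" for z k
  proof (rule zero[where S=UNIV and x=z])
    show "((\<lambda>z. k^4 * jet u 4 0 z k + \<sigma> * k^2 * jet u 2 0 z k + deriv V (u z k))
        has_real_derivative ?E0 z k) (at z)"
      by (auto intro!: derivative_eq_intros Dz[OF that] DV'(1) simp del: One_nat_def)
  qed (use eq that in auto)
  have E1: "?E1 z k = 0" if "k \<in> I" for z k
  proof (rule zero[where S=I and x=k])
    show "(?E0 z has_real_derivative ?E1 z k) (at k)"
      by (auto intro!: derivative_eq_intros Dk[OF that] DV'(2) simp del: One_nat_def simp: algebra_simps power2_eq_square)
  qed (use E0 that I in auto)
  have E2: "?E2 z k = 0" if "k \<in> I" for z k
  proof (rule zero[where S=I and x=k])
    show "(?E1 z has_real_derivative ?E2 z k) (at k)"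
      by (auto intro!: derivative_eq_intros Dk[OF that] DV'(2,3) simp del: One_nat_def simp: algebra_simps power2_eq_square)
  qed (use E1 that I in auto)
  show "?E0 z k = 0" "?E1 z k = 0" "?E2 z k = 0" using E0 E1 E2 k by blast+
qed


theorem mainTheorem6:
  fixes \<sigma> :: real and V :: "real \<Rightarrow> real" and u :: "real \<Rightarrow> real \<Rightarrow> real"
    and I :: "real set" and k :: real and \<xi>3 \<xi>3k :: "real \<Rightarrow> real"
  assumes V_smooth: "smooth_on UNIV V"
    and I_interval: "open I" "is_interval I" "0 \<notin> I"
    and u_smooth: "smooth_on (UNIV \<times> I) (\<lambda>(z, k). u z k)"
    and u_periodic: "\<forall>k\<in>I. periodic_fun_simple (\<lambda>z. u z k) (2 * pi)"
    and u_nonconstant: "\<forall>k\<in>I. \<not> (\<lambda>z. u z k) constant_on UNIV"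
    and u_equation: "\<forall>k\<in>I. \<forall>z.
      k^4 * (pdz ^^ 4) u z k + \<sigma> * k^2 * (pdz ^^ 2) u z k + deriv V (u z k) = 0"
    and k: "k \<in> I"
    and A_k: "deriv (action \<sigma> u) k = 0"
    and A_kk: "(deriv ^^ 2) (action \<sigma> u) k = 0"
    and kernel: "{f \<in> periodic4. \<forall>z. L0 V \<sigma> u k f z = 0} = range (\<lambda>c z. c * pdz u z k)"
    and xi3: "is_xi3 V \<sigma> u k \<xi>3"
    and xi3_k: "is_xi3_k V \<sigma> u k \<xi>3 \<xi>3k"
  shows "2 * kappa V \<sigma> u k \<xi>3 \<xi>3k = (deriv ^^ 3) (action \<sigma> u) k"
proof -
  have per: "u (z + 2 * pi) k = u z k" if "k \<in> I" for z k
    using u_periodic that by (auto simp: periodic_fun_simple_def)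
  have eq: "k^4 * jet u 4 0 z k + \<sigma> * k^2 * jet u 2 0 z k + deriv V (u z k) = 0"
    if "k \<in> I" for z k
    using u_equation that by (simp add: jet_def)
  note E = linearised_equation_k_derivs[OF V_smooth I_interval(1,2) u_smooth eq k]
  have pdk_M: "pdk (M \<sigma> u) z k = M_k \<sigma> u z k" for z
    unfolding pdk_def by (rule DERIV_imp_deriv) (rule M_has_k_derivs(1)[OF I_interval(1) u_smooth k])
  have X: "\<xi>3 \<in> periodic4" and eqX: "\<And>z. L0 V \<sigma> u k \<xi>3 z + M \<sigma> u z k = 0"
    using xi3 by (auto simp: is_xi3_def)
  have Y: "\<xi>3k \<in> periodic4"
    and eqY: "\<And>z. L0 V \<sigma> u k \<xi>3k z + L0_k V \<sigma> u k \<xi>3 z + M_k \<sigma> u z k = 0"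
    using xi3_k by (auto simp: is_xi3_k_def pdk_M)
  have green: "((\<lambda>z. jet u 1 j z k * (\<alpha> * (deriv ^^ 4) f z + \<beta> * (deriv ^^ 2) f z)
       - f z * (\<alpha> * jet u 5 j z k + \<beta> * jet u 3 j z k)) has_integral 0) {0..2 * pi}"
    if "f \<in> periodic4" for f j \<alpha> \<beta>
  proof -
    have "((\<lambda>z. jet u (Suc 0) j z k * (\<alpha> * (deriv ^^ 4) f z + \<beta> * (deriv ^^ 2) f z)
       - (deriv ^^ 0) f z * (\<alpha> * jet u (Suc 4) j z k + \<beta> * jet u (Suc 2) j z k))
       has_integral 0) {0..2 * pi}"
    proof (rule green_identity[where a="\<lambda>i z. jet u (Suc i) j z k" and f="\<lambda>i. (deriv ^^ i) f"])
      show "jet u (Suc i) j (2 * pi) k = jet u (Suc i) j 0 k" for i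
        using jet_periodic[where p="2*pi" and z=0 and u=u, OF I_interval(1) per k] by simp
      show "((\<lambda>z. jet u (Suc i) j z k) has_real_derivative jet u (Suc (Suc i)) j z k) (at z)" for i z
        by (rule jet_deriv_z[OF I_interval(1,2) u_smooth k])
      show "((deriv ^^ i) f has_real_derivative (deriv ^^ Suc i) f z) (at z)" if "i < 4" for i z
        by (rule periodic4_derivs(1)[OF \<open>f \<in> periodic4\<close> that])
      show "(deriv ^^ i) f (2 * pi) = (deriv ^^ i) f 0" for i
        by (rule periodic4_derivs(2)[OF that])
    qed simp
    then show ?thesis by simp
  qed
  define K where "K = (\<lambda>z. pdz u z k * (
     2 * k^3 * (pdk ^^ 3) ((pdz ^^ 3) u) z k + 15 * k^2 * (pdk ^^ 2) ((pdz ^^ 3) u) z k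
     + 24 * k * pdk ((pdz ^^ 3) u) z k + 6 * (pdz ^^ 3) u z k
     + \<sigma> * k * (pdk ^^ 3) (pdz u) z k + 5 / 2 * \<sigma> * (pdk ^^ 2) (pdz u) z k
     + 4 * k^3 * (deriv ^^ 4) \<xi>3k z + 6 * k^2 * (deriv ^^ 4) \<xi>3 z
     + 2 * \<sigma> * k * (deriv ^^ 2) \<xi>3k z + \<sigma> * (deriv ^^ 2) \<xi>3 z
     + 1 / 2 * (deriv ^^ 4) V (u z k) * (pdk u z k)^2 * \<xi>3 z
     + 1 / 2 * (deriv ^^ 3) V (u z k) * (pdk ^^ 2) u z k * \<xi>3 z
     + (deriv ^^ 3) V (u z k) * pdk u z k * \<xi>3k z))"
  define G where "G = (\<lambda>z. jet u 1 0 z k * M_kk \<sigma> u z k + 2 * jet u 1 1 z k * M_k \<sigma> u z k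
                      + jet u 1 2 z k * M \<sigma> u z k)"
  \<comment> \<open>The Green terms for \<open>L\<close> against \<open>(u\<^sub>z\<^sub>k\<^sub>k, \<xi>3)\<close> and \<open>(u\<^sub>z\<^sub>k, \<xi>3k)\<close>, for \<open>L'\<close> against \<open>(u\<^sub>z, \<xi>3k)\<close> and
    \<open>(u\<^sub>z\<^sub>k, \<xi>3)\<close>, and for \<open>L''\<close> against \<open>(u\<^sub>z, \<xi>3)\<close>. The multiplication parts of the operators
    cancel pointwise and so do not appear.\<close>
  let ?R = "\<lambda>f j \<alpha> \<beta> z. jet u 1 j z k * (\<alpha> * (deriv ^^ 4) f z + \<beta> * (deriv ^^ 2) f z)
       - f z * (\<alpha> * jet u 5 j z k + \<beta> * jet u 3 j z k)"
  let ?S = "\<lambda>z. ?R \<xi>3 2 (k^4) (\<sigma> * k^2) z + 2 * ?R \<xi>3k 1 (k^4) (\<sigma> * k^2) z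
       + 2 * ?R \<xi>3k 0 (4 * k^3) (2 * \<sigma> * k) z + 2 * ?R \<xi>3 1 (4 * k^3) (2 * \<sigma> * k) z
       + ?R \<xi>3 0 (12 * k^2) (2 * \<sigma>) z"
  have KG: "2 * K z = G z + ?S z" for z
  proof -
    have K_eq: "2 * K z = jet u 1 0 z k * (M_kk \<sigma> u z k
        + 2 * (4 * k^3 * (deriv ^^ 4) \<xi>3k z + 2 * \<sigma> * k * (deriv ^^ 2) \<xi>3k z
             + (deriv ^^ 3) V (u z k) * jet u 0 1 z k * \<xi>3k z)
        + (12 * k^2 * (deriv ^^ 4) \<xi>3 z + 2 * \<sigma> * (deriv ^^ 2) \<xi>3 z
             + ((deriv ^^ 4) V (u z k) * (jet u 0 1 z k)^2
                + (deriv ^^ 3) V (u z k) * jet u 0 2 z k) * \<xi>3 z))"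
      unfolding K_def M_kk_def by (simp add: jet_def algebra_simps)
    have M_eq: "M \<sigma> u z k = - (k^4 * (deriv ^^ 4) \<xi>3 z + \<sigma> * k^2 * (deriv ^^ 2) \<xi>3 z
        + (deriv ^^ 2) V (u z k) * \<xi>3 z)"
      using eqX[of z] by (simp add: L0_def)
    have M_k_eq: "M_k \<sigma> u z k = - (k^4 * (deriv ^^ 4) \<xi>3k z + \<sigma> * k^2 * (deriv ^^ 2) \<xi>3k z
        + (deriv ^^ 2) V (u z k) * \<xi>3k z
        + (4 * k^3 * (deriv ^^ 4) \<xi>3 z + 2 * \<sigma> * k * (deriv ^^ 2) \<xi>3 z
           + (deriv ^^ 3) V (u z k) * jet u 0 1 z k * \<xi>3 z))"
      using eqY[of z] by (simp add: L0_def L0_k_def jet_def)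
    \<comment> \<open>The two brackets are the differentiated linearised equations.\<close>
    have "2 * K z - G z - ?S z = \<xi>3 z * (
        k^4 * jet u 5 2 z k + \<sigma> * k^2 * jet u 3 2 z k + (deriv ^^ 2) V (u z k) * jet u 1 2 z k
        + 2 * (4 * k^3 * jet u 5 1 z k + 2 * \<sigma> * k * jet u 3 1 z k
           + (deriv ^^ 3) V (u z k) * jet u 0 1 z k * jet u 1 1 z k)
        + (12 * k^2 * jet u 5 0 z k + 2 * \<sigma> * jet u 3 0 z k
           + ((deriv ^^ 4) V (u z k) * (jet u 0 1 z k)^2 + (deriv ^^ 3) V (u z k) * jet u 0 2 z k)
             * jet u 1 0 z k))
      + 2 * \<xi>3k z * (
        k^4 * jet u 5 1 z k + \<sigma> * k^2 * jet u 3 1 z k + (deriv ^^ 2) V (u z k) * jet u 1 1 z k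
        + (4 * k^3 * jet u 5 0 z k + 2 * \<sigma> * k * jet u 3 0 z k
           + (deriv ^^ 3) V (u z k) * jet u 0 1 z k * jet u 1 0 z k))"
      unfolding K_eq G_def M_eq M_k_eq by (simp add: algebra_simps)
    also have "\<dots> = 0"
      using E(2,3)[of z] by simp
    finally show ?thesis by simp
  qed
  have S: "(?S has_integral 0) {0..2 * pi}"
    using has_integral_add[OF has_integral_add[OF has_integral_add[OF has_integral_add[OF
        green[OF X, of 2 "k^4" "\<sigma> * k^2"]
        has_integral_mult_right[OF green[OF Y, of 1 "k^4" "\<sigma> * k^2"], of 2]]
        has_integral_mult_right[OF green[OF Y, of 0 "4 * k^3" "2 * \<sigma> * k"], of 2]]
        has_integral_mult_right[OF green[OF X, of 1 "4 * k^3" "2 * \<sigma> * k"], of 2]]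
        green[OF X, of 0 "12 * k^2" "2 * \<sigma>"]]
    by simp
  have "continuous_on {0..2 * pi} G"
    unfolding G_def M_jet M_k_def M_kk_def
    by (intro continuous_intros continuous_on_strip_slice[OF _ k]
          jet_continuous[OF I_interval(1) u_smooth])
  then have "(G has_integral integral {0..2 * pi} G) {0..2 * pi}"
    by (intro integrable_integral integrable_continuous_real)
  from has_integral_add[OF this S]
  have "((\<lambda>z. 2 * K z) has_integral integral {0..2 * pi} G) {0..2 * pi}"
    unfolding KG by (simp only: add_0_right)
  from integral_unique[OF this] have "2 * integral {0..2 * pi} K = integral {0..2 * pi} G"
    by (simp only: integral_mult_right)
  moreover have "kappa V \<sigma> u k \<xi>3 \<xi>3k = 1 / (2 * pi) * integral {0..2 * pi} K"
    by (simp only: kappa_def inner_per_def K_def)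
  moreover have "(deriv ^^ 3) (action \<sigma> u) k = 1 / (2 * pi) * integral {0..2 * pi} G"
    using action_third_deriv[OF I_interval(1,2) u_smooth per k] by (simp only: G_def)
  ultimately show ?thesis by simp
qed

end
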